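(* Let $E$ be an infinite-dimensional Banach space over $\mathbb{F}\in\{\mathbb{R},\mathbb{C}\}$. Then $E$ is strongly Gelfand--Phillips if and only if $E$ embeds into $c_0$ (that is, $E$ is isomorphic to a subspace of $c_0$).
   Context: $\mathbb{F}$ is the field of real or complex numbers, $\omega$ is the set of nonnegative integers, $E'$ is the dual Banach space of $E$, and $c_0$ is the Banach space (over $\mathbb{F}$, with sup-norm) of null sequences. For a bounded set $B\subseteq E$ and $\chi\in E'$, put $\|\chi\|_B:=\sup\{|\chi(x)|:x\in B\}$. A subset of $E$ is precompact if its closure in $E$ is compact. $E$ has the strong Gelfand--Phillips property (is strongly Gelfand--Phillips) if there is a weak$^\ast$ null sequence $(\chi_n)_{n\in\omega}$ in $E'$ such that $\|\chi_n\|_B\not\to 0$ for every bounded non-precompact set $B\subseteq E$. Isomorphic means linearly homeomorphic (not necessarily isometric). *)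

theory Defs
  imports "HOL-Analysis.Analysis"
begin

text \<open>
  A Banach space over the scalar field \<open>'k\<close> (used with \<open>'k = real\<close> and \<open>'k = complex\<close>) is a type of
  class \<^class>\<open>banach\<close> together with an explicit scalar multiplication, since the class only provides
  multiplication by reals. The axiom \<open>scale_of_real\<close> says that the two multiplications agree.
\<close>

locale banach_over = vector_space scal
  for scal :: "'k::real_normed_field \<Rightarrow> 'a::banach \<Rightarrow> 'a" +
  assumes norm_scale: "norm (scal c x) = norm c * norm x"
    and scale_of_real: "scal (of_real r) x = r *\<^sub>R x"

lemma banach_over_scaleR: "banach_over ((*\<^sub>R) :: real \<Rightarrow> 'a::banach \<Rightarrow> 'a)"
  by unfold_locales (auto simp: algebra_simps)

lemma banach_over_mult: "banach_over ((*) :: 'k::{real_normed_field,banach} \<Rightarrow> 'k \<Rightarrow> 'k)"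
  by unfold_locales (auto simp: algebra_simps norm_mult scaleR_conv_of_real)

definition infinite_dimensional :: "('k::field \<Rightarrow> 'a::ab_group_add \<Rightarrow> 'a) \<Rightarrow> bool" where
  "infinite_dimensional scal \<longleftrightarrow> \<not> (\<exists>S. finite S \<and> module.span scal S = UNIV)"

definition dual_space :: "('k::real_normed_field \<Rightarrow> 'a::real_normed_vector \<Rightarrow> 'a) \<Rightarrow> ('a \<Rightarrow> 'k) set" where
  "dual_space scal = {\<phi>. Vector_Spaces.linear scal (*) \<phi> \<and> continuous_on UNIV \<phi>}"

definition weak_star_null ::
  "('k::real_normed_field \<Rightarrow> 'a::real_normed_vector \<Rightarrow> 'a) \<Rightarrow> (nat \<Rightarrow> 'a \<Rightarrow> 'k) \<Rightarrow> bool" where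
  "weak_star_null scal \<phi> \<longleftrightarrow>
     (\<forall>n. \<phi> n \<in> dual_space scal) \<and> (\<forall>x. (\<lambda>n. \<phi> n x) \<longlonglongrightarrow> 0)"

text \<open>
  The supremum of reals is the intended one for nonempty bounded \<open>B\<close> and \<open>\<phi>\<close> in the dual; the empty
  set is precompact, so no other case is used below.
\<close>

definition seminorm_on :: "'a set \<Rightarrow> ('a \<Rightarrow> 'k::real_normed_vector) \<Rightarrow> real" where
  "seminorm_on B \<phi> = (SUP x\<in>B. norm (\<phi> x))"

definition precompact :: "'a::topological_space set \<Rightarrow> bool" where
  "precompact B \<longleftrightarrow> compact (closure B)"

definition strongly_Gelfand_Phillips ::
  "('k::real_normed_field \<Rightarrow> 'a::real_normed_vector \<Rightarrow> 'a) \<Rightarrow> bool" where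
  "strongly_Gelfand_Phillips scal \<longleftrightarrow>
     (\<exists>\<phi>. weak_star_null scal \<phi> \<and>
        (\<forall>B. bounded B \<and> \<not> precompact B \<longrightarrow> \<not> (\<lambda>n. seminorm_on B (\<phi> n)) \<longlonglongrightarrow> 0))"

text \<open>
  Every function on the discrete space \<^typ>\<open>nat\<close> is continuous, so \<open>nat \<Rightarrow>\<^sub>C 'k\<close> is the space of bounded
  sequences with the sup-norm, and \<open>c0\<close> below carries the norm and topology induced from it.
\<close>

definition c0 :: "(nat \<Rightarrow>\<^sub>C 'k::real_normed_field) set" where
  "c0 = {f. apply_bcontfun f \<longlonglongrightarrow> 0}"

definition scale_seq :: "'k::real_normed_field \<Rightarrow> (nat \<Rightarrow>\<^sub>C 'k) \<Rightarrow> (nat \<Rightarrow>\<^sub>C 'k)" where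
  "scale_seq c f = Bcontfun (\<lambda>n. c * apply_bcontfun f n)"

lemma apply_scale_seq: "apply_bcontfun (scale_seq c f) n = c * apply_bcontfun f n"
proof -
  have "bounded (range (apply_bcontfun f))"
    using apply_bcontfun[of f] by (simp add: bcontfun_def)
  then have "bounded ((\<lambda>x. c * x) ` range (apply_bcontfun f))"
    by (rule bounded_linear_image) (rule bounded_linear_mult_right)
  then have "(\<lambda>n. c * apply_bcontfun f n) \<in> bcontfun"
    by (simp add: bcontfun_def image_image)
  then show ?thesis
    by (simp add: scale_seq_def Bcontfun_inverse)
qed

lemma vector_space_scale_seq:
  "vector_space (scale_seq :: 'k::real_normed_field \<Rightarrow> (nat \<Rightarrow>\<^sub>C 'k) \<Rightarrow> (nat \<Rightarrow>\<^sub>C 'k))"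
  by unfold_locales (auto intro!: bcontfun_eqI simp: apply_scale_seq algebra_simps)

lemma scale_seq_of_real: "scale_seq (of_real r) f = r *\<^sub>R f"
  by (rule bcontfun_eqI) (simp add: apply_scale_seq scaleR_conv_of_real)

lemma norm_scale_seq: "norm (scale_seq c f) = norm c * norm f"
proof (cases "c = 0")
  case True
  then have "scale_seq c f = 0" by (intro bcontfun_eqI) (simp add: apply_scale_seq)
  with True show ?thesis by simp
next
  case False
  have *: "norm (scale_seq d g) \<le> norm d * norm g" for d and g :: "nat \<Rightarrow>\<^sub>C 'a"
    by (rule norm_bound) (simp add: apply_scale_seq norm_mult mult_left_mono norm_bounded)
  from False have "f = scale_seq (inverse c) (scale_seq c f)"
    by (intro bcontfun_eqI) (simp add: apply_scale_seq)
  with *[of "inverse c" "scale_seq c f"] have "norm f \<le> inverse (norm c) * norm (scale_seq c f)"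
    by (simp add: norm_inverse)
  with False have "norm c * norm f \<le> norm (scale_seq c f)"
    by (simp add: field_simps)
  with *[of c f] show ?thesis by simp
qed

lemma subspace_c0: "module.subspace scale_seq (c0 :: (nat \<Rightarrow>\<^sub>C 'k::real_normed_field) set)"
proof -
  interpret vector_space "scale_seq :: 'k \<Rightarrow> _" by (rule vector_space_scale_seq)
  have "(\<lambda>n. apply_bcontfun (f + g) n) \<longlonglongrightarrow> 0" if "f \<in> c0" "g \<in> c0" for f g :: "nat \<Rightarrow>\<^sub>C 'k"
    using that tendsto_add[of f 0 sequentially g 0] by (simp add: c0_def)
  moreover have "(\<lambda>n. apply_bcontfun (scale_seq c f) n) \<longlonglongrightarrow> 0" if "f \<in> c0" for c and f :: "nat \<Rightarrow>\<^sub>C 'k"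
    using that tendsto_mult_right_zero[of f sequentially c] by (simp add: c0_def apply_scale_seq)
  moreover have "(\<lambda>n. apply_bcontfun (0 :: nat \<Rightarrow>\<^sub>C 'k) n) \<longlonglongrightarrow> 0" by simp
  ultimately show ?thesis by (intro subspaceI) (simp_all add: c0_def)
qed

definition embeds_into_c0 :: "('k::real_normed_field \<Rightarrow> 'a::real_normed_vector \<Rightarrow> 'a) \<Rightarrow> bool" where
  "embeds_into_c0 scal \<longleftrightarrow>
     (\<exists>M. M \<subseteq> c0 \<and> module.subspace scale_seq M \<and>
        (\<exists>T S. Vector_Spaces.linear scal scale_seq T \<and> homeomorphism UNIV M T S))"

end

theory Submission
  imports Defs
begin

text \<open>
  If \<open>T\<close> embeds \<open>E\<close> into \<open>c\<^sub>0\<close>, the coordinates of \<open>T\<close> form a weak-star null sequence, and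
  their suprema over a bounded set \<open>B\<close> tend to \<open>0\<close> only if the tails of the sequences in \<open>T ` B\<close> are
  uniformly small. Then \<open>T ` B\<close> is totally bounded, hence so is \<open>B\<close>, because \<open>T\<close> is bounded below
  (\<open>strongly_Gelfand_Phillips_if_embeds_into_c0\<close>).

  Conversely, a weak-star null sequence \<open>\<phi>\<close> defines an operator \<open>x \<mapsto> (\<phi> n x)\<^sub>n\<close> into \<open>c\<^sub>0\<close>,
  bounded by the uniform boundedness principle. If \<open>\<phi>\<close> witnesses the strong Gelfand--Phillips
  property, the unit sphere of its kernel is compact, as all \<open>\<phi> n\<close> vanish there. By compactness,
  finitely many functionals suffice so that no point of this sphere is a common zero, and
  putting them in front of \<open>\<phi>\<close> gives a witness for which the operator is injective
  (\<open>ex_injective_Gelfand_Phillips_sequence\<close>). The new operator \<open>T\<close> is bounded below: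
  otherwise there are unit vectors \<open>x k\<close> with \<open>T (x k) \<longlonglongrightarrow> 0\<close>; the functionals tend to \<open>0\<close> uniformly on these vectors
  (\<open>seminorm_on_range_tendsto_0\<close>), so the \<open>x k\<close> have a cluster point, which is a unit vector in
  the kernel of \<open>T\<close>.

  The first direction works over any normed field in which bounded sets are relatively compact,
  the second one over any normed field for which the dual separates points. Separation follows from the
  Hahn--Banach theorem, obtained here from minimal sublinear functionals; the complex case is
  reduced to the real one by \<open>f x - \<i> f (\<i> x)\<close>.
\<close>

section \<open>Functionals below a sublinear functional\<close>

definition sublinear :: "('a::real_vector \<Rightarrow> real) \<Rightarrow> bool" where
  "sublinear p \<longleftrightarrow> (\<forall>x y. p (x + y) \<le> p x + p y) \<and> (\<forall>t\<ge>0. \<forall>x. p (t *\<^sub>R x) = t * p x)"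

lemma sublinear_add: "sublinear p \<Longrightarrow> p (x + y) \<le> p x + p y"
  by (simp add: sublinear_def)

lemma sublinear_scaleR: "sublinear p \<Longrightarrow> 0 \<le> t \<Longrightarrow> p (t *\<^sub>R x) = t * p x"
  by (simp add: sublinear_def)

lemma sublinear_zero: "sublinear p \<Longrightarrow> p 0 = 0"
  using sublinear_scaleR[of p 0 0] by simp

lemma sublinear_ge: "sublinear p \<Longrightarrow> - p (- x) \<le> p x"
  using sublinear_add[of p x "- x"] sublinear_zero[of p] by simp

lemma sublinear_norm: "sublinear norm"
  by (simp add: sublinear_def norm_triangle_ineq)

text \<open>
  The largest sublinear functional \<open>q \<le> p\<close> with \<open>q (- y) \<le> - p y\<close>; for a linear \<open>p\<close> it is \<open>p\<close>
  itself. It is used twice: to show that a minimal sublinear functional is odd, and to prescribe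
  the value at a vector that a functional has to norm.
\<close>

definition lowered :: "('a::real_vector \<Rightarrow> real) \<Rightarrow> 'a \<Rightarrow> 'a \<Rightarrow> real" where
  "lowered p y x = (INF t\<in>{0..}. p (x + t *\<^sub>R y) - t * p y)"

text \<open>
  By subadditivity, \<open>t * p y = p (t *\<^sub>R y) \<le> p (x + t *\<^sub>R y) + p (- x)\<close>, so the infimum is a
  genuine one.
\<close>

lemma bdd_below_lowered:
  assumes "sublinear p"
  shows "bdd_below ((\<lambda>t. p (x + t *\<^sub>R y) - t * p y) ` {0..})"
proof (rule bdd_belowI2)
  fix t :: real assume "t \<in> {0..}"
  then show "- p (- x) \<le> p (x + t *\<^sub>R y) - t * p y"
    using sublinear_add[OF assms, of "x + t *\<^sub>R y" "- x"] sublinear_scaleR[OF assms, of t y] by simp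
qed

lemma lowered_le_at:
  assumes "sublinear p" "0 \<le> t"
  shows "lowered p y x \<le> p (x + t *\<^sub>R y) - t * p y"
  unfolding lowered_def by (rule cINF_lower[OF bdd_below_lowered]) (use assms in auto)

lemma lowered_le: "sublinear p \<Longrightarrow> lowered p y x \<le> p x"
  using lowered_le_at[of p 0 y x] by simp

lemma lowered_minus: "sublinear p \<Longrightarrow> lowered p y (- y) \<le> - p y"
  using lowered_le_at[of p 1 y "- y"] by (simp add: sublinear_zero)

lemma lowered_approx:
  assumes "0 < e"
  obtains t where "0 \<le> t" "p (x + t *\<^sub>R y) - t * p y < lowered p y x + e"
proof -
  have "\<exists>v\<in>(\<lambda>t. p (x + t *\<^sub>R y) - t * p y) ` {0..}. v < lowered p y x + e"
    by (rule cInf_lessD) (use assms in \<open>auto simp: lowered_def\<close>)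
  then show thesis using that by auto
qed

lemma sublinear_lowered:
  assumes p: "sublinear p"
  shows "sublinear (lowered p y)"
  unfolding sublinear_def
proof (intro conjI allI impI)
  fix u v
  show "lowered p y (u + v) \<le> lowered p y u + lowered p y v"
  proof (rule field_le_epsilon)
    fix e :: real assume "0 < e"
    then have "0 < e / 2" by simp
    then obtain s t where s: "0 \<le> s" "p (u + s *\<^sub>R y) - s * p y < lowered p y u + e / 2"
      and t: "0 \<le> t" "p (v + t *\<^sub>R y) - t * p y < lowered p y v + e / 2"
      using lowered_approx by metis
    have "lowered p y (u + v) \<le> p ((u + v) + (s + t) *\<^sub>R y) - (s + t) * p y"
      using p s t by (intro lowered_le_at) auto
    also have "(u + v) + (s + t) *\<^sub>R y = (u + s *\<^sub>R y) + (v + t *\<^sub>R y)"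
      by (simp add: algebra_simps)
    also have "p \<dots> \<le> p (u + s *\<^sub>R y) + p (v + t *\<^sub>R y)" by (rule sublinear_add[OF p])
    finally show "lowered p y (u + v) \<le> lowered p y u + lowered p y v + e"
      using s t by (simp add: algebra_simps)
  qed
next
  have le: "lowered p y (c *\<^sub>R x) \<le> c * lowered p y x" if c: "0 < c" for c x
  proof (rule field_le_epsilon)
    fix e :: real assume "0 < e"
    then have "0 < e / c" using c by simp
    then obtain t where t: "0 \<le> t" "p (x + t *\<^sub>R y) - t * p y < lowered p y x + e / c"
      using lowered_approx by metis
    have "lowered p y (c *\<^sub>R x) \<le> p (c *\<^sub>R x + (c * t) *\<^sub>R y) - c * t * p y"
      using p t c by (intro lowered_le_at) auto
    also have "p (c *\<^sub>R x + (c * t) *\<^sub>R y) = c * p (x + t *\<^sub>R y)"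
      using sublinear_scaleR[OF p, of c "x + t *\<^sub>R y"] c by (simp add: algebra_simps)
    also have "c * p (x + t *\<^sub>R y) - c * t * p y = c * (p (x + t *\<^sub>R y) - t * p y)"
      by (simp add: algebra_simps)
    also have "\<dots> \<le> c * (lowered p y x + e / c)"
      using t c by (intro mult_left_mono) auto
    also have "\<dots> = c * lowered p y x + e" using c by (simp add: field_simps)
    finally show "lowered p y (c *\<^sub>R x) \<le> c * lowered p y x + e" .
  qed
  have zero: "lowered p y 0 = 0"
  proof -
    have "lowered p y 0 = (INF t\<in>{0::real..}. 0)"
      unfolding lowered_def by (rule INF_cong) (simp_all add: sublinear_scaleR[OF p])
    then show ?thesis by simp
  qed
  fix c :: real and x
  assume "0 \<le> c"
  show "lowered p y (c *\<^sub>R x) = c * lowered p y x"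
  proof (cases "c = 0")
    case False
    with \<open>0 \<le> c\<close> have c: "0 < c" by simp
    have "lowered p y ((1/c) *\<^sub>R c *\<^sub>R x) \<le> (1/c) * lowered p y (c *\<^sub>R x)"
      using c by (intro le) simp
    then have "c * lowered p y x \<le> lowered p y (c *\<^sub>R x)"
      using c by (simp add: field_simps)
    with le[OF c, of x] show ?thesis by simp
  qed (simp add: zero)
qed

text \<open>
  Minimality forces \<open>lowered p y = p\<close> and so \<open>p (- y) \<le> - p y\<close>. A sublinear functional that is
  odd is linear: superadditivity is subadditivity at the negated vectors.
\<close>

lemma linear_if_minimal_sublinear:
  assumes p: "sublinear p"
    and min: "\<And>q. sublinear q \<Longrightarrow> (\<And>x. q x \<le> p x) \<Longrightarrow> q = p"
  shows "linear p"
proof -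
  have "lowered p y = p" for y
    by (rule min) (simp_all add: sublinear_lowered lowered_le p)
  then have "p (- y) \<le> - p y" for y
    using lowered_minus[OF p, of y] by simp
  then have odd: "p (- y) = - p y" for y
    using sublinear_ge[OF p, of y] by (simp add: order_antisym minus_le_iff)
  show ?thesis
  proof (rule linearI)
    fix x y
    have "- p (x + y) \<le> - p x - p y"
      using sublinear_add[OF p, of "- x" "- y"] odd[of x] odd[of y] odd[of "x + y"] by simp
    with sublinear_add[OF p, of x y] show "p (x + y) = p x + p y" by simp
  next
    fix r x
    show "p (r *\<^sub>R x) = r *\<^sub>R p x"
    proof (cases "0 \<le> r")
      case False
      then show ?thesis
        using sublinear_scaleR[OF p, of "- r" x] odd[of "r *\<^sub>R x"] by simp
    qed (simp add: sublinear_scaleR[OF p])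
  qed
qed

text \<open>
  The common bound \<open>p\<close> gives the lower bound \<open>- p (- x)\<close> for all values at \<open>x\<close>. The chain condition
  is what makes the infimum subadditive: two functionals that are nearly optimal at \<open>x\<close> and at \<open>y\<close>
  can be replaced by the smaller of the two.
\<close>

lemma sublinear_Inf_chain:
  fixes p :: "'a::real_vector \<Rightarrow> real"
  assumes ne: "C \<noteq> {}"
    and sub: "\<And>q. q \<in> C \<Longrightarrow> sublinear q" and le: "\<And>q x. q \<in> C \<Longrightarrow> q x \<le> p x"
    and chain: "\<And>q r. q \<in> C \<Longrightarrow> r \<in> C \<Longrightarrow> q \<le> r \<or> r \<le> q"
  shows "sublinear (\<lambda>x. INF q\<in>C. q x)" and "\<And>q x. q \<in> C \<Longrightarrow> (INF q\<in>C. q x) \<le> q x"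
proof -
  have bdd: "bdd_below ((\<lambda>q. q x) ` C)" for x
  proof (rule bdd_belowI2)
    fix q assume q: "q \<in> C"
    show "- p (- x) \<le> q x" using sublinear_ge[OF sub[OF q], of x] le[OF q, of "- x"] by simp
  qed
  then show low: "(INF q\<in>C. q x) \<le> q x" if "q \<in> C" for q x
    using that by (intro cINF_lower)
  have approx: "\<exists>q\<in>C. q x < (INF q\<in>C. q x) + e" if "0 < e" for x e
    using cInf_lessD[of "(\<lambda>q. q x) ` C" "(INF q\<in>C. q x) + e"] ne that by auto
  show "sublinear (\<lambda>x. INF q\<in>C. q x)"
    unfolding sublinear_def
  proof (intro conjI allI impI)
    fix x y
    show "(INF q\<in>C. q (x + y)) \<le> (INF q\<in>C. q x) + (INF q\<in>C. q y)"
    proof (rule field_le_epsilon)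
      fix e :: real assume "0 < e"
      then have "0 < e / 2" by simp
      then obtain q r where q: "q \<in> C" "q x < (INF q\<in>C. q x) + e / 2"
        and r: "r \<in> C" "r y < (INF q\<in>C. q y) + e / 2"
        using approx by meson
      obtain s where s: "s \<in> C" "s x \<le> q x" "s y \<le> r y"
        using chain[OF q(1) r(1)] q(1) r(1) by (meson le_funD order_refl)
      have "(INF q\<in>C. q (x + y)) \<le> s (x + y)" by (rule low[OF s(1)])
      also have "\<dots> \<le> s x + s y" by (rule sublinear_add[OF sub[OF s(1)]])
      finally show "(INF q\<in>C. q (x + y)) \<le> (INF q\<in>C. q x) + (INF q\<in>C. q y) + e"
        using s q r by simp
    qed
  next
    have le: "(INF q\<in>C. q (t *\<^sub>R x)) \<le> t * (INF q\<in>C. q x)" if t: "0 < t" for t x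
    proof -
      have "(INF q\<in>C. q (t *\<^sub>R x)) / t \<le> (INF q\<in>C. q x)"
      proof (rule cINF_greatest[OF ne])
        fix q assume q: "q \<in> C"
        show "(INF q\<in>C. q (t *\<^sub>R x)) / t \<le> q x"
          using low[OF q, of "t *\<^sub>R x"] sublinear_scaleR[OF sub[OF q], of t x] t
          by (simp add: field_simps)
      qed
      with t show ?thesis by (simp add: field_simps)
    qed
    fix t :: real and x
    assume "0 \<le> t"
    show "(INF q\<in>C. q (t *\<^sub>R x)) = t * (INF q\<in>C. q x)"
    proof (cases "t = 0")
      case True
      have "(INF q\<in>C. q 0) = (INF q\<in>C. (0::real))"
        by (rule INF_cong) (simp_all add: sub sublinear_zero)
      then show ?thesis using True ne by simp
    next
      case False
      with \<open>0 \<le> t\<close> have t: "0 < t" by simp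
      have "(INF q\<in>C. q ((1/t) *\<^sub>R t *\<^sub>R x)) \<le> (1/t) * (INF q\<in>C. q (t *\<^sub>R x))"
        using t by (intro le) simp
      then have "t * (INF q\<in>C. q x) \<le> (INF q\<in>C. q (t *\<^sub>R x))"
        using t by (simp add: field_simps)
      with le[OF t, of x] show ?thesis by simp
    qed
  qed
qed

text \<open>
  The Hahn--Banach theorem in the form of an existence statement: Zorn's lemma for the reverse
  pointwise order gives a minimal sublinear functional below \<open>p\<close>.
\<close>

lemma linear_below_sublinear:
  fixes p :: "'a::real_vector \<Rightarrow> real"
  assumes "sublinear p"
  obtains f where "linear f" "\<And>x. f x \<le> p x"
proof -
  define A where "A = {q. sublinear q \<and> q \<le> p}"
  have "\<exists>m\<in>A. \<forall>a\<in>A. m \<ge> a \<longrightarrow> a = m"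
  proof (rule predicate_Zorn)
    show "partial_order_on A (relation_of (\<lambda>q r. q \<ge> r) A)"
      by (rule partial_order_on_relation_ofI) auto
  next
    fix C assume C: "C \<in> Chains (relation_of (\<lambda>q r. q \<ge> r) A)"
    then have CA: "C \<subseteq> A" and chain: "\<And>q r. q \<in> C \<Longrightarrow> r \<in> C \<Longrightarrow> q \<le> r \<or> r \<le> q"
      by (auto simp: Chains_def relation_of_def)
    show "\<exists>u\<in>A. \<forall>a\<in>C. a \<ge> u"
    proof (cases "C = {}")
      case True
      then show ?thesis using assms by (auto simp: A_def)
    next
      case False
      have sub: "\<And>q. q \<in> C \<Longrightarrow> sublinear q" and le: "\<And>q x. q \<in> C \<Longrightarrow> q x \<le> p x"
        using CA by (auto simp: A_def le_fun_def)
      let ?u = "\<lambda>x. INF q\<in>C. q x"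
      have sub_u: "sublinear ?u"
        by (rule sublinear_Inf_chain(1)[where p = p]) (use False sub le chain in blast)+
      have "?u x \<le> q x" if "q \<in> C" for q x
        by (rule sublinear_Inf_chain(2)[where p = p]) (use False sub le chain that in blast)+
      then have u: "\<forall>a\<in>C. ?u \<le> a" by (auto simp: le_fun_def)
      obtain q where "q \<in> C" using False by blast
      then have "?u \<le> p" using u CA by (auto simp: A_def intro: order_trans)
      with sub_u u show ?thesis unfolding A_def by blast
    qed
  qed
  then obtain m where m: "m \<in> A" "\<And>a. a \<in> A \<Longrightarrow> a \<le> m \<Longrightarrow> a = m" by blast
  have "linear m"
  proof (rule linear_if_minimal_sublinear)
    fix q assume "sublinear q" "\<And>x. q x \<le> m x"
    then show "q = m" using m(1) by (intro m(2)) (auto simp: A_def le_fun_def intro: order_trans)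
  qed (use m in \<open>simp add: A_def\<close>)
  with m(1) show thesis by (intro that) (auto simp: A_def le_fun_def)
qed

text \<open>
  A linear functional below \<open>lowered norm x\<^sub>0\<close> is at most the norm, and its value at \<open>- x\<^sub>0\<close> is at
  most \<open>- norm x\<^sub>0\<close>.
\<close>

lemma norming_functional:
  fixes x\<^sub>0 :: "'a::real_normed_vector"
  obtains f :: "'a \<Rightarrow> real" where "bounded_linear f" "norm x\<^sub>0 \<le> f x\<^sub>0"
proof -
  obtain f where f: "linear f" "\<And>x. f x \<le> lowered norm x\<^sub>0 x"
    using linear_below_sublinear[OF sublinear_lowered[OF sublinear_norm]] by metis
  have le: "f x \<le> norm x" for x
    using f(2)[of x] lowered_le[OF sublinear_norm, of x\<^sub>0 x] by linarith
  have "norm (f x) \<le> norm x * 1" for x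
    using le[of x] le[of "- x"] by (simp add: linear_neg[OF f(1)] abs_le_iff)
  with f(1) have "bounded_linear f"
    by (meson bounded_linear.intro bounded_linear_axioms.intro)
  moreover have "norm x\<^sub>0 \<le> f x\<^sub>0"
    using f(2)[of "- x\<^sub>0"] lowered_minus[OF sublinear_norm, of x\<^sub>0] by (simp add: linear_neg[OF f(1)])
  ultimately show thesis by (rule that)
qed

section \<open>Separation of points by the dual space\<close>

lemma real_dual_space_separates:
  fixes scal :: "real \<Rightarrow> 'a::banach \<Rightarrow> 'a"
  assumes "banach_over scal" "x \<noteq> 0"
  shows "\<exists>f\<in>dual_space scal. f x \<noteq> 0"
proof -
  interpret banach_over scal by fact
  obtain f :: "'a \<Rightarrow> real" where f: "bounded_linear f" "norm x \<le> f x" by (rule norming_functional)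
  have "scal = (*\<^sub>R)" using scale_of_real by (intro ext) simp
  then have "Vector_Spaces.linear scal (*) f"
    unfolding Vector_Spaces.linear_iff
    using vector_space_axioms vector_space_over_itself.vector_space_axioms bounded_linear.linear[OF f(1)]
    by (auto simp: linear_add linear_cmul)
  then have "f \<in> dual_space scal" by (simp add: dual_space_def linear_continuous_on f)
  moreover have "f x \<noteq> 0" using f(2) assms(2) by auto
  ultimately show ?thesis by blast
qed

text \<open>
  A real functional \<open>f\<close> is the real part of the complex-linear functional \<open>f y - \<i> f (\<i> y)\<close>.
\<close>

lemma complex_dual_space_separates:
  fixes scal :: "complex \<Rightarrow> 'a::banach \<Rightarrow> 'a"
  assumes "banach_over scal" "x \<noteq> 0"
  shows "\<exists>f\<in>dual_space scal. f x \<noteq> 0"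
proof -
  interpret banach_over scal by fact
  obtain f :: "'a \<Rightarrow> real" where f: "bounded_linear f" "norm x \<le> f x" by (rule norming_functional)
  interpret f: bounded_linear f by (rule f)
  define g where "g y = Complex (f y) (- f (scal \<i> y))" for y
  have scal: "scal c y = Re c *\<^sub>R y + Im c *\<^sub>R scal \<i> y" for c y
  proof -
    have "c = of_real (Re c) + of_real (Im c) * \<i>" by (simp add: complex_eq_iff)
    then have "scal c y = scal (of_real (Re c)) y + scal (of_real (Im c)) (scal \<i> y)"
      by (metis scale_left_distrib scale_scale)
    then show ?thesis by (simp only: scale_of_real)
  qed
  have i: "scal \<i> (scal c y) = Re c *\<^sub>R scal \<i> y - Im c *\<^sub>R y" for c y
    using scal[of "\<i> * c" y] by simp
  have g_scale: "g (scal c y) = c * g y" for c y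
    unfolding g_def i by (subst scal) (simp add: complex_eq_iff f.add f.diff f.scaleR algebra_simps)
  have g_add: "g (y + z) = g y + g z" for y z
    by (simp add: g_def complex_eq_iff f.add scale_right_distrib)
  have "Vector_Spaces.linear scal (*) g"
    unfolding Vector_Spaces.linear_iff
    by (simp add: g_add g_scale vector_space_axioms vector_space_over_itself.vector_space_axioms)
  moreover have "continuous_on UNIV g"
  proof -
    have "bounded_linear (scal \<i>)"
    proof (rule bounded_linear_intro[where K = 1])
      show "scal \<i> (r *\<^sub>R y) = r *\<^sub>R scal \<i> y" for r y
        using scale_left_commute[of \<i> "of_real r" y] by (simp only: scale_of_real)
    qed (simp_all add: scale_right_distrib norm_scale)
    then have "bounded_linear (\<lambda>y. f (scal \<i> y))"
      by (rule bounded_linear_compose[OF f(1)])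
    then show ?thesis
      unfolding g_def using f(1)
      by (intro continuous_on_Complex continuous_on_minus) (rule linear_continuous_on, assumption)+
  qed
  ultimately have "g \<in> dual_space scal" by (simp add: dual_space_def)
  moreover have "g x \<noteq> 0" using f(2) assms(2) by (auto simp: g_def complex_eq_iff)
  ultimately show ?thesis by blast
qed

section \<open>Bounds for linear operators\<close>

text \<open>
  Continuity at \<open>0\<close> of the inverse of \<open>f\<close>, written without mentioning the inverse, already bounds
  \<open>f\<close> below: apply it to unit vectors.
\<close>

lemma bounded_below_if_small:
  assumes lin: "linear f" and d: "0 < d" and small: "\<And>x. norm (f x) < d \<Longrightarrow> norm x < 1"
  shows "d * norm x \<le> norm (f x)"
proof (cases "x = 0")
  case False
  have "\<not> norm (f (x /\<^sub>R norm x)) < d"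
    using small[of "x /\<^sub>R norm x"] False by auto
  then have "d \<le> norm (f x) / norm x"
    using False by (simp add: linear_cmul[OF lin] divide_inverse mult.commute)
  then show ?thesis using False by (simp add: field_simps)
qed simp

lemma bounded_linear_if_continuous:
  assumes lin: "linear f" and cont: "continuous_on UNIV f"
  shows "bounded_linear f"
proof -
  have "isCont f 0" using cont by (simp add: continuous_on_eq_continuous_at)
  then obtain d where d: "0 < d" "\<And>x. norm x < d \<Longrightarrow> norm (f x) < 1"
    unfolding continuous_at_eps_delta
    by (metis dist_0_norm dist_commute linear_0[OF lin] zero_less_one)
  have "norm (f x) \<le> norm x * (2 / d)" for x
  proof (cases "x = 0")
    case False
    let ?c = "d / 2 / norm x"
    have "norm (?c *\<^sub>R x) < d" using False d by simp
    then have "norm (f (?c *\<^sub>R x)) < 1" by (rule d)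
    then have "?c * norm (f x) < 1" using d by (simp add: linear_cmul[OF lin])
    then show ?thesis using False d by (simp add: field_simps)
  qed (simp add: linear_0[OF lin])
  with lin show ?thesis by (meson bounded_linear.intro bounded_linear_axioms.intro)
qed

text \<open>
  By the Baire category theorem one of the closed sets on which all \<open>\<phi> n\<close> are bounded by \<open>N\<close>
  contains a ball of radius \<open>r\<close>; a difference of two points of it is a vector of any direction and
  length \<open>r / 2\<close> on which all \<open>\<phi> n\<close> are bounded by \<open>2 * N\<close>.
\<close>

lemma uniform_boundedness:
  fixes \<phi> :: "nat \<Rightarrow> 'a::banach \<Rightarrow> 'b::real_normed_vector"
  assumes lin: "\<And>n. bounded_linear (\<phi> n)"
    and bdd: "\<And>x. bounded (range (\<lambda>n. \<phi> n x))"
  shows "\<exists>K. \<forall>n x. norm (\<phi> n x) \<le> K * norm x"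
proof -
  define A where "A N = {x. \<forall>n. norm (\<phi> n x) \<le> real N}" for N
  have "closed (A N)" for N
    unfolding A_def
    by (intro closed_Collect_all closed_Collect_le continuous_intros
          linear_continuous_on lin)
  moreover have "(\<Union>N. A N) = UNIV"
  proof (intro equalityI subset_UNIV subsetI)
    fix x
    obtain c where "\<And>n. norm (\<phi> n x) \<le> c" using bdd[of x] by (auto simp: bounded_iff)
    moreover obtain N where "c \<le> real N" using real_arch_simple by blast
    ultimately show "x \<in> (\<Union>N. A N)" by (auto simp: A_def intro: order_trans)
  qed
  ultimately obtain N where "interior (A N) \<noteq> {}"
    using Baire_category_alt[of "euclidean :: 'a topology" "range A"]
      completely_metrizable_space_euclidean[where 'a='a]
    by (auto simp: closed_closedin[symmetric])
  then obtain a r where r: "0 < r" "ball a r \<subseteq> A N" by (auto simp: mem_interior)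
  have "norm (\<phi> n x) \<le> (4 * real N / r) * norm x" for n x
  proof (cases "x = 0")
    case False
    define t where "t = r / (2 * norm x)"
    have t: "0 < t" using r False by (simp add: t_def)
    have "norm (t *\<^sub>R x) = r / 2" using r False by (simp add: t_def)
    then have "a + t *\<^sub>R x \<in> A N" "a \<in> A N" using r by (auto simp: subset_iff dist_norm)
    then have "norm (\<phi> n (a + t *\<^sub>R x) - \<phi> n a) \<le> real N + real N"
      unfolding A_def by (intro order_trans[OF norm_triangle_ineq4] add_mono) auto
    then have "t * norm (\<phi> n x) \<le> 2 * real N"
      using t by (simp add: linear_add linear_cmul bounded_linear.linear[OF lin])
    then have "norm (\<phi> n x) \<le> (2 * real N) / t" using t by (simp add: field_simps)
    also have "(2 * real N) / t = (4 * real N / r) * norm x" using r False by (simp add: t_def)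
    finally show ?thesis .
  qed (simp add: linear_0 bounded_linear.linear[OF lin])
  then show ?thesis by blast
qed

lemma (in banach_over) dual_space_bounded_linear:
  assumes "\<phi> \<in> dual_space scal"
  shows "bounded_linear \<phi>"
proof -
  interpret L: Vector_Spaces.linear scal "(*)" \<phi>
    using assms by (simp add: dual_space_def)
  have "\<phi> (r *\<^sub>R x) = r *\<^sub>R \<phi> x" for r x
    using L.scale[of "of_real r" x] by (simp add: scale_of_real scaleR_conv_of_real)
  then have "linear \<phi>" by (intro linearI) (simp_all add: L.add)
  then show ?thesis
    using assms by (intro bounded_linear_if_continuous) (simp_all add: dual_space_def)
qed

section \<open>Total boundedness\<close>

lemma precompact_iff_totally_bounded:
  fixes B :: "'a::complete_space set"
  shows "precompact B \<longleftrightarrow> (\<forall>e>0. \<exists>k. finite k \<and> B \<subseteq> (\<Union>x\<in>k. ball x e))"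
proof
  assume "precompact B"
  then have "\<forall>e>0. \<exists>k. finite k \<and> closure B \<subseteq> (\<Union>x\<in>k. ball x e)"
    by (simp add: precompact_def compact_eq_totally_bounded)
  then show "\<forall>e>0. \<exists>k. finite k \<and> B \<subseteq> (\<Union>x\<in>k. ball x e)"
    using closure_subset by (metis order_trans)
next
  assume tb: "\<forall>e>0. \<exists>k. finite k \<and> B \<subseteq> (\<Union>x\<in>k. ball x e)"
  have "\<exists>k. finite k \<and> closure B \<subseteq> (\<Union>x\<in>k. ball x e)" if "0 < e" for e
  proof -
    have "0 < e / 2" using that by simp
    from tb[rule_format, OF this] obtain k
      where k: "finite k" "B \<subseteq> (\<Union>x\<in>k. ball x (e/2))" by blast
    have "closure B \<subseteq> (\<Union>x\<in>k. cball x (e/2))"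
    proof (rule closure_minimal)
      show "B \<subseteq> (\<Union>x\<in>k. cball x (e/2))" using k(2) by (rule order_trans) (intro UN_mono ball_subset_cball order_refl)
      show "closed (\<Union>x\<in>k. cball x (e/2))" using k(1) by auto
    qed
    also have "\<dots> \<subseteq> (\<Union>x\<in>k. ball x e)" using that by (intro UN_mono) auto
    finally show ?thesis using k(1) by blast
  qed
  then show "precompact B"
    by (simp add: precompact_def compact_eq_totally_bounded complete_eq_closed)
qed

text \<open>
  Induction on \<open>N\<close>: each piece is cut further by a finite cover of the relatively compact set
  \<open>\<phi> N ` B\<close> with small balls.
\<close>

lemma finite_partition_small_oscillation:
  fixes \<phi> :: "nat \<Rightarrow> 'a \<Rightarrow> 'k::heine_borel"
  assumes bdd: "\<And>n. bounded (\<phi> n ` B)" and e: "0 < e"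
  shows "\<exists>\<C>. finite \<C> \<and> B \<subseteq> \<Union>\<C> \<and> (\<forall>C\<in>\<C>. \<forall>x\<in>C. \<forall>y\<in>C. \<forall>n<N. dist (\<phi> n x) (\<phi> n y) \<le> e)"
proof (induction N)
  case 0
  show ?case by (rule exI[of _ "{B}"]) auto
next
  case (Suc N)
  obtain \<C> where \<C>: "finite \<C>" "B \<subseteq> \<Union>\<C>"
    "\<And>C x y n. C \<in> \<C> \<Longrightarrow> x \<in> C \<Longrightarrow> y \<in> C \<Longrightarrow> n < N \<Longrightarrow> dist (\<phi> n x) (\<phi> n y) \<le> e"
    using Suc.IH by metis
  have "compact (closure (\<phi> N ` B))" using bdd by (simp add: compact_closure)
  then obtain k where k: "finite k" "closure (\<phi> N ` B) \<subseteq> (\<Union>z\<in>k. ball z (e/2))"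
    using half_gt_zero[OF e] unfolding compact_eq_totally_bounded by metis
  let ?D = "(\<lambda>(C, z). C \<inter> \<phi> N -` ball z (e/2)) ` (\<C> \<times> k)"
  have "finite ?D" using \<C>(1) k(1) by simp
  moreover have "B \<subseteq> \<Union>?D"
  proof
    fix x assume x: "x \<in> B"
    then have "\<phi> N x \<in> (\<Union>z\<in>k. ball z (e/2))" using k(2) closure_subset[of "\<phi> N ` B"] by (meson imageI subsetD)
    then obtain z where "z \<in> k" "\<phi> N x \<in> ball z (e/2)" by blast
    moreover obtain C where "C \<in> \<C>" "x \<in> C" using x \<C>(2) by auto
    ultimately show "x \<in> \<Union>?D"
      by (intro UnionI[of "C \<inter> \<phi> N -` ball z (e/2)"]) auto
  qed
  moreover have "dist (\<phi> n x) (\<phi> n y) \<le> e"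
    if C: "C \<in> ?D" and x: "x \<in> C" and y: "y \<in> C" and n: "n < Suc N" for C x y n
  proof -
    obtain C' z where C': "C' \<in> \<C>" "C = C' \<inter> \<phi> N -` ball z (e/2)"
      using C by (auto simp del: vimage_Int)
    show ?thesis
    proof (cases "n = N")
      case True
      then show ?thesis
        using x y C'(2) dist_triangle_half_r[of z "\<phi> N x" e "\<phi> N y"] by simp
    next
      case False
      with n have "n < N" by simp
      then show ?thesis using x y C' \<C>(3)[of C' x y n] by simp
    qed
  qed
  ultimately show ?case by (intro exI[of _ ?D]) meson
qed

lemma norm_le_seminorm_on:
  assumes "bounded (\<phi> ` B)" "x \<in> B"
  shows "norm (\<phi> x) \<le> seminorm_on B \<phi>"
  unfolding seminorm_on_def
proof (rule cSUP_upper[OF assms(2)])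
  show "bdd_above ((\<lambda>x. norm (\<phi> x)) ` B)"
    using assms(1) by (auto simp: bounded_iff bdd_above_def)
qed

section \<open>Subspaces of the space of null sequences\<close>

text \<open>
  Only finitely many coordinates are not already uniformly small on \<open>B\<close>, and \<open>B\<close> splits into
  finitely many pieces on which these vary little. The hypothesis \<open>below\<close> says that \<open>d * norm x\<close> is
  at most the supremum of all \<open>norm (\<phi> n x)\<close>, so each piece has small diameter.
\<close>

lemma precompact_if_coordinates_uniformly_null:
  fixes \<phi> :: "nat \<Rightarrow> 'a::banach \<Rightarrow> 'k::{real_normed_field,heine_borel}"
  assumes lin: "\<And>n. bounded_linear (\<phi> n)"
    and d: "0 < d" and below: "\<And>x e. (\<And>n. norm (\<phi> n x) \<le> e) \<Longrightarrow> d * norm x \<le> e"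
    and B: "bounded B" and null: "(\<lambda>n. seminorm_on B (\<phi> n)) \<longlonglongrightarrow> 0"
  shows "precompact B"
  unfolding precompact_iff_totally_bounded
proof (intro allI impI)
  fix e :: real assume e: "0 < e"
  define \<eta> where "\<eta> = d * e / 2"
  have \<eta>: "0 < \<eta>" using d e by (simp add: \<eta>_def)
  have bdd: "bounded (\<phi> n ` B)" for n
    by (rule bounded_linear_image[OF B lin])
  obtain N where N: "\<And>n. n \<ge> N \<Longrightarrow> seminorm_on B (\<phi> n) < \<eta> / 2"
    using order_tendstoD(2)[OF null, of "\<eta> / 2"] \<eta> by (auto simp: eventually_sequentially)
  obtain \<C> where \<C>: "finite \<C>" "B \<subseteq> \<Union>\<C>"
    "\<And>C x y n. C \<in> \<C> \<Longrightarrow> x \<in> C \<Longrightarrow> y \<in> C \<Longrightarrow> n < N \<Longrightarrow> dist (\<phi> n x) (\<phi> n y) \<le> \<eta>"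
    using finite_partition_small_oscillation[where \<phi> = \<phi> and B = B and N = N, OF bdd \<eta>] by metis
  \<comment> \<open>a representative in \<open>B\<close> of each piece that meets \<open>B\<close>\<close>
  define p where "p C = (SOME x. x \<in> C \<inter> B)" for C
  have "x \<in> (\<Union>z\<in>p ` \<C>. ball z e)" if x: "x \<in> B" for x
  proof -
    obtain C where C: "C \<in> \<C>" "x \<in> C" using x \<C>(2) by auto
    then have p: "p C \<in> C \<inter> B" using x someI[of "\<lambda>x. x \<in> C \<inter> B" x] by (simp add: p_def)
    have "norm (\<phi> n (x - p C)) \<le> \<eta>" for n
    proof (cases "n < N")
      case True
      then show ?thesis
        using \<C>(3)[OF C(1), of x "p C" n] C p
        by (simp add: dist_norm linear_diff bounded_linear.linear[OF lin])
    next
      case False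
      then have small: "norm (\<phi> n y) < \<eta> / 2" if "y \<in> B" for y
        using N[of n] norm_le_seminorm_on[OF bdd that, of n] by simp
      have "norm (\<phi> n x - \<phi> n (p C)) \<le> norm (\<phi> n x) + norm (\<phi> n (p C))"
        by (rule norm_triangle_ineq4)
      also have "\<dots> \<le> \<eta>" using small[OF x] small[of "p C"] p by simp
      finally show ?thesis by (simp add: linear_diff bounded_linear.linear[OF lin])
    qed
    then have "d * norm (x - p C) \<le> \<eta>" by (rule below)
    then have "norm (x - p C) \<le> e / 2" using d by (simp add: \<eta>_def)
    then have "dist (p C) x < e" using e by (simp add: dist_norm norm_minus_commute)
    then show ?thesis using C by auto
  qed
  then show "\<exists>k. finite k \<and> B \<subseteq> (\<Union>x\<in>k. ball x e)"
    using \<C>(1) by (intro exI[of _ "p ` \<C>"]) blast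
qed

lemma strongly_Gelfand_Phillips_if_embeds_into_c0:
  fixes scal :: "'k::{real_normed_field,heine_borel} \<Rightarrow> 'a::banach \<Rightarrow> 'a"
  assumes "banach_over scal" and "embeds_into_c0 scal"
  shows "strongly_Gelfand_Phillips scal"
proof -
  interpret banach_over scal by fact
  obtain M T S where M: "M \<subseteq> c0" and linT: "Vector_Spaces.linear scal scale_seq T"
    and hom: "homeomorphism UNIV M T S"
    using assms(2) by (auto simp: embeds_into_c0_def)
  interpret T: Vector_Spaces.linear scal scale_seq T by (rule linT)
  have Tc0: "T x \<in> c0" for x using hom M by (auto simp: homeomorphism_def)
  have "T (r *\<^sub>R x) = r *\<^sub>R T x" for r x
    using T.scale[of "of_real r" x] by (simp add: scale_of_real scale_seq_of_real)
  then have lin: "linear T" by (intro linearI) (simp_all add: T.add)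
  have bl: "bounded_linear T"
    using hom by (intro bounded_linear_if_continuous[OF lin]) (simp add: homeomorphism_def)
  obtain d where d: "0 < d" "\<And>x. d * norm x \<le> norm (T x)"
  proof -
    have TM: "T x \<in> M" "S (T x) = x" for x using hom by (auto simp: homeomorphism_def)
    have "continuous_on M S" "0 \<in> M" "S 0 = 0"
      using hom TM[of 0] T.zero by (simp_all add: homeomorphism_def)
    then obtain d where d: "0 < d" "\<And>g. g \<in> M \<Longrightarrow> norm g < d \<Longrightarrow> norm (S g) < 1"
      unfolding continuous_on_iff by (metis dist_0_norm dist_commute zero_less_one)
    have "norm x < 1" if "norm (T x) < d" for x using d(2)[OF TM(1) that] by (simp add: TM(2))
    then show thesis using that[OF d(1)] bounded_below_if_small[OF lin d(1)] by blast
  qed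
  define \<phi> where "\<phi> n x = apply_bcontfun (T x) n" for n x
  have dual: "\<phi> n \<in> dual_space scal" for n
  proof -
    have "Vector_Spaces.linear scal (*) (\<phi> n)"
      unfolding Vector_Spaces.linear_iff
      by (simp add: \<phi>_def T.add T.scale apply_scale_seq vector_space_axioms
            vector_space_over_itself.vector_space_axioms)
    moreover have "continuous_on UNIV (\<phi> n)"
    proof -
      have "linear (\<phi> n)"
        by (rule linearI) (simp_all add: \<phi>_def linear_add[OF lin] linear_cmul[OF lin])
      moreover obtain K where "\<And>x. norm (T x) \<le> norm x * K"
        using bounded_linear.bounded[OF bl] by auto
      then have "\<And>x. norm (\<phi> n x) \<le> norm x * K"
        unfolding \<phi>_def by (meson norm_bounded order_trans)
      ultimately have "bounded_linear (\<phi> n)"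
        by (meson bounded_linear.intro bounded_linear_axioms.intro)
      then show ?thesis by (rule linear_continuous_on)
    qed
    ultimately show ?thesis by (simp add: dual_space_def)
  qed
  have "weak_star_null scal \<phi>"
    using Tc0 dual by (simp add: weak_star_null_def \<phi>_def c0_def)
  moreover have "precompact B" if "bounded B" "(\<lambda>n. seminorm_on B (\<phi> n)) \<longlonglongrightarrow> 0" for B
  proof (rule precompact_if_coordinates_uniformly_null[OF _ d(1) _ that])
    show "bounded_linear (\<phi> n)" for n by (rule dual_space_bounded_linear[OF dual])
    show "d * norm x \<le> e" if "\<And>n. norm (\<phi> n x) \<le> e" for x e
      using d(2)[of x] norm_bound[of "T x" e] that by (simp add: \<phi>_def)
  qed
  ultimately show ?thesis by (auto simp: strongly_Gelfand_Phillips_def)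
qed

section \<open>Embedding a strongly Gelfand--Phillips space\<close>

text \<open>
  The unit sphere of the common kernel is bounded and all functionals vanish on it, so it is
  compact. The open sets where a functional is nonzero cover it, and a finite subcover provides
  the functionals to be added. Finitely many new terms change no limit.
\<close>

lemma ex_injective_Gelfand_Phillips_sequence:
  fixes scal :: "'k::real_normed_field \<Rightarrow> 'a::banach \<Rightarrow> 'a"
  assumes "banach_over scal"
    and sep: "\<And>x. x \<noteq> 0 \<Longrightarrow> \<exists>f\<in>dual_space scal. f x \<noteq> 0"
    and "strongly_Gelfand_Phillips scal"
  obtains \<psi> where "weak_star_null scal \<psi>"
    and "\<And>B. bounded B \<Longrightarrow> (\<lambda>n. seminorm_on B (\<psi> n)) \<longlonglongrightarrow> 0 \<Longrightarrow> precompact B"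
    and "\<And>x. \<forall>n. \<psi> n x = 0 \<Longrightarrow> x = 0"
proof -
  interpret banach_over scal by fact
  obtain \<phi> where wsn: "weak_star_null scal \<phi>"
    and GP: "\<And>B. bounded B \<Longrightarrow> (\<lambda>n. seminorm_on B (\<phi> n)) \<longlonglongrightarrow> 0 \<Longrightarrow> precompact B"
    using assms(3) by (auto simp: strongly_Gelfand_Phillips_def)
  have lin: "bounded_linear (\<phi> n)" for n
    using wsn by (intro dual_space_bounded_linear) (simp add: weak_star_null_def)
  define F where "F = {x. (\<forall>n. \<phi> n x = 0) \<and> norm x = 1}"
  have "precompact F"
  proof (cases "F = {}")
    case False
    then have "seminorm_on F (\<phi> n) = 0" for n
      by (simp add: seminorm_on_def F_def cong: SUP_cong_simp)
    then show ?thesis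
      by (intro GP) (auto simp: F_def bounded_iff)
  qed (simp add: precompact_def)
  moreover have "closed F"
    unfolding F_def
    by (intro closed_Collect_conj closed_Collect_all closed_Collect_eq continuous_intros
          linear_continuous_on lin)
  ultimately have "compact F" by (simp add: precompact_def)
  obtain g where g: "\<And>x. x \<noteq> 0 \<Longrightarrow> g x \<in> dual_space scal" "\<And>x. x \<noteq> 0 \<Longrightarrow> g x x \<noteq> 0"
    using sep by metis
  have nz: "x \<noteq> 0" if "x \<in> F" for x using that by (auto simp: F_def)
  have "open {y. g x y \<noteq> 0}" if "x \<in> F" for x
    using g(1)[OF nz[OF that]] by (intro open_Collect_neq) (simp_all add: dual_space_def)
  moreover have "F \<subseteq> (\<Union>x\<in>F. {y. g x y \<noteq> 0})" using g(2) nz by blast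
  ultimately obtain D where D: "D \<subseteq> F" "finite D" "F \<subseteq> (\<Union>x\<in>D. {y. g x y \<noteq> 0})"
    by (rule compactE_image[OF \<open>compact F\<close>])
  obtain xs where xs: "set xs = D" using finite_list[OF D(2)] by blast
  let ?m = "length xs"
  \<comment> \<open>the new functionals come first, the given sequence is shifted by their number\<close>
  define \<psi> where "\<psi> n = (if n < ?m then g (xs ! n) else \<phi> (n - ?m))" for n
  have shift: "\<psi> (n + ?m) = \<phi> n" for n by (simp add: \<psi>_def)
  show thesis
  proof (rule that[of \<psi>])
    have "\<psi> n \<in> dual_space scal" for n
    proof (cases "n < ?m")
      case True
      then have "xs ! n \<in> F" using D(1) xs nth_mem by blast
      then show ?thesis using True by (simp add: \<psi>_def g(1) nz)
    next
      case False
      then show ?thesis using wsn by (simp add: \<psi>_def weak_star_null_def)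
    qed
    moreover have "(\<lambda>n. \<psi> n x) \<longlonglongrightarrow> 0" for x
      using wsn by (simp add: shift weak_star_null_def LIMSEQ_offset[where k = ?m])
    ultimately show "weak_star_null scal \<psi>" by (simp add: weak_star_null_def)
  next
    fix B :: "'a set" assume "bounded B" "(\<lambda>n. seminorm_on B (\<psi> n)) \<longlonglongrightarrow> 0"
    then show "precompact B"
      using LIMSEQ_ignore_initial_segment[of "\<lambda>n. seminorm_on B (\<psi> n)" 0 ?m]
      by (intro GP) (simp_all add: shift)
  next
    fix x assume "\<forall>n. \<psi> n x = 0"
    then have x: "\<psi> n x = 0" for n by blast
    show "x = 0"
    proof (rule ccontr)
      assume "x \<noteq> 0"
      let ?u = "x /\<^sub>R norm x"
      have "\<phi> n x = 0" for n using x[of "n + ?m"] by (simp add: shift)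
      then have "?u \<in> F"
        using \<open>x \<noteq> 0\<close> by (simp add: F_def linear_cmul bounded_linear.linear[OF lin])
      then obtain y where y: "y \<in> D" "g y ?u \<noteq> 0" using D(3) by blast
      obtain n where n: "n < ?m" "xs ! n = y" using y(1) xs by (metis in_set_conv_nth)
      have "bounded_linear (g y)"
        using y(1) D(1) by (intro dual_space_bounded_linear g(1) nz) blast
      moreover have "g y x = 0" using x[of n] n by (simp add: \<psi>_def)
      ultimately have "g y ?u = 0" by (simp add: linear_cmul bounded_linear.linear)
      with y(2) show False by simp
    qed
  qed
qed

text \<open>
  The bounds \<open>a k\<close> handle all large \<open>k\<close> at once; for each of the finitely many others pointwise
  convergence suffices.
\<close>

lemma seminorm_on_range_tendsto_0:
  fixes \<phi> :: "nat \<Rightarrow> 'a \<Rightarrow> 'k::real_normed_vector"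
  assumes null: "\<And>x. (\<lambda>n. \<phi> n x) \<longlonglongrightarrow> 0"
    and le: "\<And>n k. norm (\<phi> n (x k)) \<le> a k" and a: "a \<longlonglongrightarrow> 0"
  shows "(\<lambda>n. seminorm_on (range x) (\<phi> n)) \<longlonglongrightarrow> 0"
proof (rule LIMSEQ_I)
  fix e :: real assume "0 < e"
  then have e: "0 < e / 2" by simp
  obtain k\<^sub>0 where k\<^sub>0: "\<And>k. k \<ge> k\<^sub>0 \<Longrightarrow> a k < e / 2"
    using order_tendstoD(2)[OF a e] by (auto simp: eventually_sequentially)
  have "\<forall>\<^sub>F n in sequentially. \<forall>k\<in>{..<k\<^sub>0}. norm (\<phi> n (x k)) < e / 2"
    by (rule eventually_ball_finite[OF finite_lessThan])
      (intro ballI order_tendstoD(2)[OF tendsto_norm_zero[OF null] e])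
  then obtain N where N: "\<And>n k. n \<ge> N \<Longrightarrow> k < k\<^sub>0 \<Longrightarrow> norm (\<phi> n (x k)) < e / 2"
    unfolding eventually_sequentially by (metis lessThan_iff)
  have "norm (seminorm_on (range x) (\<phi> n) - 0) < e" if n: "n \<ge> N" for n
  proof -
    have le_e: "norm (\<phi> n (x k)) \<le> e / 2" for k
      using N[OF n, of k] k\<^sub>0[of k] le[of n k] by (cases "k < k\<^sub>0") auto
    then have "seminorm_on (range x) (\<phi> n) \<le> e / 2"
      unfolding seminorm_on_def by (intro cSUP_least) auto
    moreover have "norm (\<phi> n (x 0)) \<le> seminorm_on (range x) (\<phi> n)"
    proof (rule norm_le_seminorm_on)
      show "bounded (\<phi> n ` range x)" using le_e by (intro boundedI[where B = "e / 2"]) auto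
    qed simp
    ultimately show ?thesis using e norm_ge_zero[of "\<phi> n (x 0)"] unfolding real_norm_def by linarith
  qed
  then show "\<exists>N. \<forall>n\<ge>N. norm (seminorm_on (range x) (\<phi> n) - 0) < e" by blast
qed

text \<open>
  The embedding is \<open>x \<mapsto> (\<psi> n x)\<^sub>n\<close> for an injective witness \<open>\<psi>\<close>. That it is bounded below uses the
  Gelfand--Phillips property a second time, on the range of a sequence of unit vectors.
\<close>

lemma embeds_into_c0_if_strongly_Gelfand_Phillips:
  fixes scal :: "'k::real_normed_field \<Rightarrow> 'a::banach \<Rightarrow> 'a"
  assumes "banach_over scal"
    and sep: "\<And>x. x \<noteq> 0 \<Longrightarrow> \<exists>f\<in>dual_space scal. f x \<noteq> 0"
    and "strongly_Gelfand_Phillips scal"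
  shows "embeds_into_c0 scal"
proof -
  interpret banach_over scal by fact
  obtain \<psi> where wsn: "weak_star_null scal \<psi>"
    and GP: "\<And>B. bounded B \<Longrightarrow> (\<lambda>n. seminorm_on B (\<psi> n)) \<longlonglongrightarrow> 0 \<Longrightarrow> precompact B"
    and inj: "\<And>x. \<forall>n. \<psi> n x = 0 \<Longrightarrow> x = 0"
    by (rule ex_injective_Gelfand_Phillips_sequence[OF assms]) (blast | metis)+
  have null: "(\<lambda>n. \<psi> n x) \<longlonglongrightarrow> 0" for x using wsn by (simp add: weak_star_null_def)
  have lin: "bounded_linear (\<psi> n)" for n
    using wsn by (intro dual_space_bounded_linear) (simp add: weak_star_null_def)
  have \<psi>_linear: "Vector_Spaces.linear scal (*) (\<psi> n)" for n
    using wsn by (simp add: weak_star_null_def dual_space_def)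
  have bdd: "bounded (range (\<lambda>n. \<psi> n x))" for x
    using convergent_imp_bounded[OF null] .
  obtain K where K: "\<And>n x. norm (\<psi> n x) \<le> K * norm x"
    using uniform_boundedness[of \<psi>, OF lin bdd] by blast
  define T where "T x = Bcontfun (\<lambda>n. \<psi> n x)" for x
  have T: "apply_bcontfun (T x) n = \<psi> n x" for x n
    unfolding T_def using bdd[of x] by (simp add: Bcontfun_inverse bcontfun_def)
  have linT: "Vector_Spaces.linear scal scale_seq T"
    unfolding Vector_Spaces.linear_iff using \<psi>_linear[unfolded Vector_Spaces.linear_iff]
    by (auto intro!: bcontfun_eqI vector_space_scale_seq simp: T apply_scale_seq vector_space_axioms)
  have rlinT: "linear T"
    by (rule linearI; rule bcontfun_eqI)
      (simp_all add: T linear_add linear_cmul bounded_linear.linear[OF lin])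
  have "norm (T x) \<le> norm x * K" for x
    using norm_bound[of "T x" "norm x * K"] K by (simp add: T mult.commute)
  with rlinT have blT: "bounded_linear T"
    by (meson bounded_linear.intro bounded_linear_axioms.intro)
  obtain d where d: "0 < d" "\<And>x. d * norm x \<le> norm (T x)"
  proof (rule ccontr)
    assume "\<not> thesis"
    then have "\<exists>x. norm (T x) < inverse (real (Suc k)) \<and> \<not> norm x < 1" for k
      using bounded_below_if_small[OF rlinT, of "inverse (real (Suc k))"] that
      by (metis inverse_positive_iff_positive of_nat_0_less_iff zero_less_Suc)
    then obtain y where y: "\<And>k. norm (T (y k)) < inverse (real (Suc k))" "\<And>k. \<not> norm (y k) < 1"
      by metis
    \<comment> \<open>normalizing only makes the images smaller, because \<open>y k\<close> has norm at least \<open>1\<close>\<close>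
    define x where "x k = y k /\<^sub>R norm (y k)" for k
    have "y k \<noteq> 0" for k using y(2)[of k] by auto
    then have norm_x: "norm (x k) = 1" for k by (simp add: x_def)
    have Tx: "norm (T (x k)) < inverse (real (Suc k))" for k
    proof -
      have "norm (T (x k)) = norm (T (y k)) / norm (y k)"
        by (simp add: x_def linear_cmul[OF rlinT] divide_inverse mult.commute)
      also have "\<dots> \<le> norm (T (y k))"
        using y(2)[of k] mult_left_mono[of 1 "norm (y k)" "norm (T (y k))"]
        by (simp add: divide_le_eq)
      finally show ?thesis using y(1)[of k] by simp
    qed
    have Tx0: "(\<lambda>k. norm (T (x k))) \<longlonglongrightarrow> 0"
      by (rule tendsto_sandwich[OF _ _ tendsto_const LIMSEQ_inverse_real_of_nat])
        (use Tx less_imp_le in \<open>auto intro!: always_eventually\<close>)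
    have "(\<lambda>n. seminorm_on (range x) (\<psi> n)) \<longlonglongrightarrow> 0"
      using norm_bounded[of "T (x _)"] by (intro seminorm_on_range_tendsto_0[OF null _ Tx0]) (simp add: T)
    moreover have "bounded (range x)" using norm_x by (auto simp: bounded_iff)
    ultimately have "compact (closure (range x))" using GP by (simp add: precompact_def)
    moreover have "\<forall>k. x k \<in> closure (range x)" using closure_subset[of "range x"] by auto
    ultimately obtain l r where r: "strict_mono r" "(x \<circ> r) \<longlonglongrightarrow> l"
      using seq_compactE[OF compact_imp_seq_compact] by metis
    have "(\<lambda>k. norm (x (r k))) \<longlonglongrightarrow> norm l" using r(2) by (intro tendsto_norm) (simp add: o_def)
    then have "norm l = 1" by (simp add: norm_x LIMSEQ_const_iff)
    have "(\<lambda>k. norm (T (x (r k)))) \<longlonglongrightarrow> norm (T l)"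
      using r(2) by (intro tendsto_norm bounded_linear.tendsto[OF blT]) (simp add: o_def)
    moreover have "(\<lambda>k. norm (T (x (r k)))) \<longlonglongrightarrow> 0"
      using LIMSEQ_subseq_LIMSEQ[OF Tx0 r(1)] by (simp add: o_def)
    ultimately have "T l = 0" using LIMSEQ_unique by fastforce
    then have "l = 0" using T[of l] by (intro inj allI) simp
    with \<open>norm l = 1\<close> show False by simp
  qed
  have injT: "inj T"
  proof (rule injI)
    fix a b assume "T a = T b"
    then show "a = b" using d(1) d(2)[of "a - b"] by (simp add: linear_diff[OF rlinT] mult_le_0_iff)
  qed
  interpret T: Vector_Spaces.linear scal scale_seq T by (rule linT)
  have "(1/d)-lipschitz_on (range T) (inv T)"
  proof (rule lipschitz_onI)
    fix f g assume "f \<in> range T" "g \<in> range T"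
    then obtain a b where ab: "f = T a" "g = T b" by blast
    show "dist (inv T f) (inv T g) \<le> 1/d * dist f g"
      using d(1) d(2)[of "a - b"] injT
      by (simp add: ab dist_norm linear_diff[OF rlinT] field_simps)
  qed (use d in simp)
  then have "continuous_on (range T) (inv T)" by (rule lipschitz_on_continuous_on)
  then have "homeomorphism UNIV (range T) T (inv T)"
    using injT linear_continuous_on[OF blT] by (intro homeomorphismI) auto
  moreover have "range T \<subseteq> c0"
  proof -
    have "apply_bcontfun (T x) = (\<lambda>n. \<psi> n x)" for x by (rule ext) (rule T)
    then show ?thesis using null by (auto simp: c0_def)
  qed
  moreover have "module.subspace scale_seq (range T)"
    by (rule T.subspace_image[OF subspace_UNIV])
  ultimately show ?thesis using linT unfolding embeds_into_c0_def by blast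
qed

section \<open>The characterization\<close>

theorem theorem3p1:
  fixes scaleRe :: "real \<Rightarrow> 'a::banach \<Rightarrow> 'a"
    and scaleCo :: "complex \<Rightarrow> 'b::banach \<Rightarrow> 'b"
  shows "(banach_over scaleRe \<and> infinite_dimensional scaleRe \<longrightarrow>
            (strongly_Gelfand_Phillips scaleRe \<longleftrightarrow> embeds_into_c0 scaleRe)) \<and>
         (banach_over scaleCo \<and> infinite_dimensional scaleCo \<longrightarrow>
            (strongly_Gelfand_Phillips scaleCo \<longleftrightarrow> embeds_into_c0 scaleCo))"
proof (intro conjI impI)
  assume "banach_over scaleRe \<and> infinite_dimensional scaleRe"
  then have Re: "banach_over scaleRe" by (rule conjunct1)
  show "strongly_Gelfand_Phillips scaleRe \<longleftrightarrow> embeds_into_c0 scaleRe"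
    using strongly_Gelfand_Phillips_if_embeds_into_c0[OF Re]
      embeds_into_c0_if_strongly_Gelfand_Phillips[OF Re real_dual_space_separates[OF Re]]
    by (rule iffI[rotated])
next
  assume "banach_over scaleCo \<and> infinite_dimensional scaleCo"
  then have Co: "banach_over scaleCo" by (rule conjunct1)
  show "strongly_Gelfand_Phillips scaleCo \<longleftrightarrow> embeds_into_c0 scaleCo"
    using strongly_Gelfand_Phillips_if_embeds_into_c0[OF Co]
      embeds_into_c0_if_strongly_Gelfand_Phillips[OF Co complex_dual_space_separates[OF Co]]
    by (rule iffI[rotated])
qed

end
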